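(* Let $\ell$ be a fixed positive integer. For every positive integer $k$, every finite graph $G$ and every set $A\subseteq V(G)$, the graph $G$ either contains $k$ pairwise vertex-disjoint long $A$-paths, or there is a vertex set $X\subseteq V(G)$ with $|X|\leq 4k\ell$ that meets every long $A$-path in $G$.
   Context: For a vertex set $A$, an $A$-path is a path with at least one edge whose two endvertices lie in $A$ and none of whose interior vertices lie in $A$. The length of a path is its number of edges. A path is long if its length is at least $\ell$. *)

theory Defs
  imports Main
begin

definition finite_graph :: "'a set \<Rightarrow> ('a \<Rightarrow> 'a \<Rightarrow> bool) \<Rightarrow> bool" where
  "finite_graph V E \<longleftrightarrow> finite V \<and> (\<forall>u v. E u v \<longrightarrow> E v u) \<and> (\<forall>v. \<not> E v v)
     \<and> (\<forall>u v. E u v \<longrightarrow> u \<in> V \<and> v \<in> V)"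

definition is_path :: "'a set \<Rightarrow> ('a \<Rightarrow> 'a \<Rightarrow> bool) \<Rightarrow> 'a list \<Rightarrow> bool" where
  "is_path V E p \<longleftrightarrow> p \<noteq> [] \<and> distinct p \<and> set p \<subseteq> V
     \<and> (\<forall>i. Suc i < length p \<longrightarrow> E (p ! i) (p ! Suc i))"

definition path_len :: "'a list \<Rightarrow> nat" where
  "path_len p = length p - 1"

definition is_A_path :: "'a set \<Rightarrow> ('a \<Rightarrow> 'a \<Rightarrow> bool) \<Rightarrow> 'a set \<Rightarrow> 'a list \<Rightarrow> bool" where
  "is_A_path V E A p \<longleftrightarrow> is_path V E p \<and> path_len p \<ge> 1
     \<and> hd p \<in> A \<and> last p \<in> A \<and> (\<forall>i. 0 < i \<and> i < path_len p \<longrightarrow> p ! i \<notin> A)"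

definition long_A_path :: "nat \<Rightarrow> 'a set \<Rightarrow> ('a \<Rightarrow> 'a \<Rightarrow> bool) \<Rightarrow> 'a set \<Rightarrow> 'a list \<Rightarrow> bool" where
  "long_A_path l V E A p \<longleftrightarrow> is_A_path V E A p \<and> path_len p \<ge> l"

end

theory Submission
  imports Defs
begin

text \<open>
  Consider subcubic forests in \<open>G\<close> (frames) whose vertices in \<open>A\<close> are exactly their leaves and in
  which any two leaves of a component are at distance at least \<open>l\<close>. A component with \<open>t\<close> leaves
  contains \<open>t div 2\<close> disjoint leaf-to-leaf paths, all of them long \<open>A\<close>-paths. Let \<open>X\<close> consist of the
  vertices of degree 3 and of the vertices at distance less than \<open>l\<close>, within the frame, from a leaf.
  Assigning the latter to a nearest leaf splits them into subtrees of depth less than \<open>l\<close>, and as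
  there are at most \<open>t - 2\<close> branchings, a component contributes at most \<open>(2 * t - 2) * l\<close> vertices,
  that is, at most \<open>4 * l\<close> per disjoint path. A long \<open>A\<close>-path that avoids \<open>X\<close> is either disjoint from
  the frame and forms a new component, or its initial segment up to the frame can be attached,
  because it ends in a vertex of degree 2 that is far from all leaves. So \<open>X\<close> is a hitting set for
  a maximal frame.
\<close>

section \<open>Rooted trees with at most two branches at a vertex\<close>

text \<open>A component of a frame is rooted at one of its leaves \<open>r\<close>; what hangs below \<open>r\<close> is a tree of the
  following kind.\<close>

datatype (verts: 'a) btree =
    Leaf (root: 'a)
  | Node1 (root: 'a) "'a btree"
  | Node2 (root: 'a) "'a btree" "'a btree"

primrec leaves :: "'a btree \<Rightarrow> nat" where
  "leaves (Leaf a) = 1"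
| "leaves (Node1 x t) = leaves t"
| "leaves (Node2 x t u) = leaves t + leaves u"

primrec min_depth :: "'a btree \<Rightarrow> nat" where
  "min_depth (Leaf a) = 0"
| "min_depth (Node1 x t) = Suc (min_depth t)"
| "min_depth (Node2 x t u) = Suc (min (min_depth t) (min_depth u))"

fun chain :: "'a list \<Rightarrow> 'a btree" where
  "chain [] = undefined"
| "chain [a] = Leaf a"
| "chain (x # y # xs) = Node1 x (chain (y # xs))"

lemma finite_verts [simp]: "finite (verts t)"
  by (induction t) auto

lemma verts_chain: "xs \<noteq> [] \<Longrightarrow> verts (chain xs) = set xs"
  by (induction xs rule: chain.induct) auto

lemma root_chain: "xs \<noteq> [] \<Longrightarrow> root (chain xs) = hd xs"
  by (induction xs rule: chain.induct) auto

lemma min_depth_chain: "xs \<noteq> [] \<Longrightarrow> min_depth (chain xs) = length xs - 1"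
  by (induction xs rule: chain.induct) auto

section \<open>Paths and \<open>A\<close>-paths as lists\<close>

lemma is_path_iff_successively:
  "is_path V E p \<longleftrightarrow> p \<noteq> [] \<and> distinct p \<and> set p \<subseteq> V \<and> successively E p"
  by (auto simp: is_path_def successively_conv_nth)

lemma is_A_path_iff:
  "is_A_path V E A p \<longleftrightarrow>
     (\<exists>a m b. p = a # m @ [b] \<and> is_path V E p \<and> a \<in> A \<and> b \<in> A \<and> set m \<inter> A = {})"
proof
  assume p: "is_A_path V E A p"
  then obtain a q where aq: "p = a # q" "q \<noteq> []"
    unfolding is_A_path_def is_path_def path_len_def by (cases p) fastforce+
  then obtain m b where mb: "p = a # m @ [b]"
    by (metis append_butlast_last_id)
  have "m ! i \<notin> A" if "i < length m" for i
    using p that unfolding is_A_path_def path_len_def mb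
    by (auto simp: nth_append dest!: spec[of _ "Suc i"])
  then have "set m \<inter> A = {}"
    by (auto simp: in_set_conv_nth)
  then show "\<exists>a m b. p = a # m @ [b] \<and> is_path V E p \<and> a \<in> A \<and> b \<in> A \<and> set m \<inter> A = {}"
    using p unfolding is_A_path_def mb by auto
next
  assume "\<exists>a m b. p = a # m @ [b] \<and> is_path V E p \<and> a \<in> A \<and> b \<in> A \<and> set m \<inter> A = {}"
  then obtain a m b where p: "p = a # m @ [b]" "is_path V E p" "a \<in> A" "b \<in> A" "set m \<inter> A = {}"
    by blast
  have "p ! i \<notin> A" if "0 < i" "i < path_len p" for i
    using that p(5) unfolding p(1) path_len_def
    by (cases i) (auto simp: nth_append dest: nth_mem)
  then show "is_A_path V E A p"
    using p unfolding is_A_path_def by (auto simp: path_len_def)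
qed

section \<open>Packings of disjoint long \<open>A\<close>-paths\<close>

locale long_A_paths =
  fixes l :: nat and V A :: "'a set" and E :: "'a \<Rightarrow> 'a \<Rightarrow> bool"
  assumes l_pos: "l > 0" and graph: "finite_graph V E" and A_subset: "A \<subseteq> V"
begin

lemma finite_V: "finite V"
  using graph by (simp add: finite_graph_def)

lemma E_sym: "E u v \<Longrightarrow> E v u"
  using graph by (simp add: finite_graph_def)

lemma successively_rev: "successively E (rev p) = successively E p"
  unfolding List.successively_rev using E_sym by (metis (no_types) successively_mono)

text \<open>Confining the paths to \<open>W\<close> makes packings in disjoint sets additive, as the
  bottom-up construction requires.\<close>

definition packing :: "'a set \<Rightarrow> nat \<Rightarrow> bool" where
  "packing W n \<longleftrightarrow> (\<exists>ps. length ps = n \<and> (\<forall>p\<in>set ps. long_A_path l V E A p \<and> set p \<subseteq> W)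
     \<and> sorted_wrt (\<lambda>p q. set p \<inter> set q = {}) ps)"

lemma packing_0 [simp]: "packing W 0"
  by (simp add: packing_def)

lemma packing_1: "long_A_path l V E A p \<Longrightarrow> packing (set p) 1"
  unfolding packing_def by (rule exI[of _ "[p]"]) auto

lemma packing_mono: "packing W n \<Longrightarrow> W \<subseteq> W' \<Longrightarrow> packing W' n"
  unfolding packing_def by blast

lemma packing_Un:
  assumes "packing W n" "packing W' n'" "W \<inter> W' = {}"
  shows "packing (W \<union> W') (n + n')"
proof -
  obtain ps qs where
    "length ps = n" "\<forall>p\<in>set ps. long_A_path l V E A p \<and> set p \<subseteq> W"
    "sorted_wrt (\<lambda>p q. set p \<inter> set q = {}) ps"
    "length qs = n'" "\<forall>p\<in>set qs. long_A_path l V E A p \<and> set p \<subseteq> W'"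
    "sorted_wrt (\<lambda>p q. set p \<inter> set q = {}) qs"
    using assms(1,2) unfolding packing_def by blast
  then show ?thesis
    unfolding packing_def using assms(3)
    by (intro exI[of _ "ps @ qs"]) (auto simp: sorted_wrt_append; blast)
qed

lemma packing_imp_disjoint_paths:
  assumes "packing W n" "k \<le> n"
  shows "\<exists>P :: nat \<Rightarrow> 'a list. (\<forall>i<k. long_A_path l V E A (P i))
           \<and> (\<forall>i<k. \<forall>j<k. i \<noteq> j \<longrightarrow> set (P i) \<inter> set (P j) = {})"
proof -
  obtain ps where ps: "length ps = n" "\<forall>p\<in>set ps. long_A_path l V E A p"
    "sorted_wrt (\<lambda>p q. set p \<inter> set q = {}) ps"
    using assms(1) unfolding packing_def by blast
  have less: "set (ps ! i) \<inter> set (ps ! j) = {}" if "i < j" "j < k" for i j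
    using ps(1,3) that assms(2) by (simp add: sorted_wrt_iff_nth_less)
  have "set (ps ! i) \<inter> set (ps ! j) = {}" if "i < k" "j < k" "i \<noteq> j" for i j
    using less[of i j] less[of j i] that by (cases i j rule: linorder_cases) auto
  then show ?thesis
    using ps(1,2) assms(2) by (intro exI[of _ "\<lambda>i. ps ! i"]) auto
qed

section \<open>Trees in a frame and the vertices near their leaves\<close>

text \<open>A path between two leaves turns at a branching, so bounding the distance of the nearest
  leaves on both sides of each \<open>Node2\<close> keeps all leaves of the tree at least
  \<open>l\<close> apart.\<close>

primrec frame_tree :: "'a btree \<Rightarrow> bool" where
  "frame_tree (Leaf a) \<longleftrightarrow> a \<in> A"
| "frame_tree (Node1 x t) \<longleftrightarrow> x \<in> V - A \<and> x \<notin> verts t \<and> E x (root t) \<and> frame_tree t"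
| "frame_tree (Node2 x t u) \<longleftrightarrow> x \<in> V - A \<and> x \<notin> verts t \<and> x \<notin> verts u \<and> verts t \<inter> verts u = {}
     \<and> E x (root t) \<and> E x (root u) \<and> frame_tree t \<and> frame_tree u
     \<and> min_depth t + min_depth u + 2 \<ge> l"

text \<open>The part of \<open>X\<close> in a subtree of a component, where \<open>d\<close> is the distance from the root of the
  subtree to the nearest leaf of the component outside the subtree.\<close>

primrec near :: "'a btree \<Rightarrow> nat \<Rightarrow> 'a set" where
  "near (Leaf a) d = {a}"
| "near (Node1 x t) d = (if d < l \<or> min_depth t + 1 < l then {x} else {}) \<union> near t (d + 1)"
| "near (Node2 x t u) d = {x} \<union> near t (min (d + 1) (min_depth u + 2))
                            \<union> near u (min (d + 1) (min_depth t + 2))"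

lemma frame_tree_verts_subset: "frame_tree t \<Longrightarrow> verts t \<subseteq> V"
  using A_subset by (induction t) auto

lemma near_subset: "near t d \<subseteq> verts t"
  by (induction t arbitrary: d) (simp; blast)+

lemma frame_tree_A_near: "frame_tree t \<Longrightarrow> verts t \<inter> A \<subseteq> near t d"
  by (induction t arbitrary: d) (simp; blast)+

text \<open>The summand \<open>l - d\<close> pays for the vertices reached by the nearest leaf above the subtree, and
  the vertices above the subtree that its own nearest leaf reaches are already paid for.\<close>

lemma card_near:
  "card (near t d) + (l - (min_depth t + 1)) + l \<le> (l - d) + 2 * leaves t * l"
proof (induction t arbitrary: d)
  case (Leaf a)
  then show ?case using l_pos by simp
next
  case (Node1 x t)
  have "card (near (Node1 x t) d) \<le> (if d < l \<or> min_depth t + 1 < l then 1 else 0) + card (near t (d + 1))"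
    using card_Un_le[of "{x}" "near t (d + 1)"] by auto
  \<comment> \<open>If \<open>x\<close> is counted, then \<open>l - d\<close> or
    \<open>l - (min_depth t + 1)\<close> is positive; it drops by one in passing \<open>x\<close>,
    which pays for \<open>x\<close>.\<close>
  with Node1[of "d + 1"] show ?case
    by (auto split: if_splits)
next
  case (Node2 x t u)
  define d1 d2 where "d1 = min (d + 1) (min_depth u + 2)" and "d2 = min (d + 1) (min_depth t + 2)"
  have "card (near (Node2 x t u) d) \<le> 1 + card (near t d1) + card (near u d2)"
    unfolding near.simps d1_def[symmetric] d2_def[symmetric]
    using card_Un_le[of "{x} \<union> near t d1" "near u d2"] card_Un_le[of "{x}" "near t d1"] by simp
  moreover have "card (near t d1) + (l - (min_depth t + 1)) + l \<le> (l - d1) + 2 * leaves t * l"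
    "card (near u d2) + (l - (min_depth u + 1)) + l \<le> (l - d2) + 2 * leaves u * l"
    using Node2 by blast+
  \<comment> \<open>Each of the three differences on the left is the maximum of two of
    \<open>l - d\<close>, \<open>l - (min_depth t + 1)\<close> and
    \<open>l - (min_depth u + 1)\<close>, lowered by one if positive. Together they use the largest
    twice and the middle one once, and the second use costs at most \<open>l\<close>.\<close>
  moreover have "1 + (l - d1) + (l - d2) + (l - (min (min_depth t) (min_depth u) + 2))
      \<le> (l - d) + l + (l - (min_depth t + 1)) + (l - (min_depth u + 1))"
    unfolding d1_def d2_def using l_pos by (simp add: min_def) arith
  ultimately show ?case
    by (simp add: algebra_simps)
qed

text \<open>The paths are found bottom-up; an odd subtree passes a path from its root to one unused leaf
  on to its parent.\<close>

lemma frame_tree_packing: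
  assumes "frame_tree t"
  shows "(even (leaves t) \<longrightarrow> packing (verts t) (leaves t div 2)) \<and>
    (odd (leaves t) \<longrightarrow> (\<exists>m b. is_path V E (m @ [b]) \<and> b \<in> A \<and> set m \<inter> A = {}
       \<and> hd (m @ [b]) = root t \<and> set (m @ [b]) \<subseteq> verts t \<and> length m \<ge> min_depth t
       \<and> packing (verts t - set (m @ [b])) (leaves t div 2)))"
    (is "?even t \<and> ?odd t")
  using assms
proof (induction t)
  case (Leaf a)
  have "is_path V E ([] @ [a])"
    using Leaf A_subset by (auto simp: is_path_iff_successively)
  with Leaf show ?case
    by (auto intro!: exI[of _ "[]"] exI[of _ a])
next
  case (Node1 x t)
  have extend: "is_path V E (x # q)"
    if "is_path V E q" "hd q = root t" "set q \<subseteq> verts t" for q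
    using that Node1.prems by (cases q) (auto simp: is_path_iff_successively)
  show ?case
  proof (intro conjI impI)
    assume "even (leaves (Node1 x t))"
    then show "packing (verts (Node1 x t)) (leaves (Node1 x t) div 2)"
      using Node1 by (auto elim: packing_mono)
  next
    assume "odd (leaves (Node1 x t))"
    then obtain m b where q: "is_path V E (m @ [b])" "b \<in> A" "set m \<inter> A = {}"
      "hd (m @ [b]) = root t" "set (m @ [b]) \<subseteq> verts t" "length m \<ge> min_depth t"
      "packing (verts t - set (m @ [b])) (leaves t div 2)"
      using Node1 by auto
    have "packing (verts (Node1 x t) - set ((x # m) @ [b])) (leaves (Node1 x t) div 2)"
      using q(7) Node1.prems by (auto elim!: packing_mono)
    then show "\<exists>m b. is_path V E (m @ [b]) \<and> b \<in> A \<and> set m \<inter> A = {}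
       \<and> hd (m @ [b]) = root (Node1 x t) \<and> set (m @ [b]) \<subseteq> verts (Node1 x t)
       \<and> length m \<ge> min_depth (Node1 x t)
       \<and> packing (verts (Node1 x t) - set (m @ [b])) (leaves (Node1 x t) div 2)"
      using q extend[OF q(1,4,5)] Node1.prems by (intro exI[of _ "x # m"] exI[of _ b]) auto
  qed
next
  case (Node2 x t u)
  have lift: "?odd (Node2 x t u)"
    if asms: "frame_tree t" "frame_tree u" "E x (root t)" "x \<in> V - A" "x \<notin> verts t" "x \<notin> verts u"
      "verts t \<inter> verts u = {}" "?odd t" "?even u" "even (leaves u)" for t u
  proof
    assume "odd (leaves (Node2 x t u))"
    then have odd: "odd (leaves t)" and div: "leaves (Node2 x t u) div 2 = leaves t div 2 + leaves u div 2"
      using asms(10) by auto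
    obtain m b where q: "is_path V E (m @ [b])" "b \<in> A" "set m \<inter> A = {}"
      "hd (m @ [b]) = root t" "set (m @ [b]) \<subseteq> verts t" "length m \<ge> min_depth t"
      "packing (verts t - set (m @ [b])) (leaves t div 2)"
      using asms(8) odd by auto
    have "is_path V E ((x # m) @ [b])"
      using q(1,4,5) asms(3-5) by (cases m) (auto simp: is_path_iff_successively)
    moreover have "packing ((verts t - set (m @ [b])) \<union> verts u) (leaves t div 2 + leaves u div 2)"
      using q(7) asms(7,9,10) by (intro packing_Un) auto
    then have "packing (verts (Node2 x t u) - set ((x # m) @ [b])) (leaves (Node2 x t u) div 2)"
      unfolding div by (rule packing_mono) (use q(5) asms(5,6,7) in auto)
    ultimately show "\<exists>m b. is_path V E (m @ [b]) \<and> b \<in> A \<and> set m \<inter> A = {}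
       \<and> hd (m @ [b]) = root (Node2 x t u) \<and> set (m @ [b]) \<subseteq> verts (Node2 x t u)
       \<and> length m \<ge> min_depth (Node2 x t u)
       \<and> packing (verts (Node2 x t u) - set (m @ [b])) (leaves (Node2 x t u) div 2)"
      using q asms by (intro exI[of _ "x # m"] exI[of _ b]) auto
  qed
  have swap: "?odd (Node2 x u t) \<Longrightarrow> ?odd (Node2 x t u)"
    by (simp add: Un_commute add.commute min.commute)
  have IH: "?even t" "?odd t" "?even u" "?odd u"
    using Node2 by auto
  consider "even (leaves t)" "even (leaves u)" | "odd (leaves t)" "even (leaves u)"
    | "even (leaves t)" "odd (leaves u)" | "odd (leaves t)" "odd (leaves u)"
    by blast
  then show ?case
  proof cases
    case 1
    then have "packing (verts t \<union> verts u) (leaves t div 2 + leaves u div 2)"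
      using IH Node2.prems by (intro packing_Un) auto
    then have "packing (verts (Node2 x t u)) (leaves t div 2 + leaves u div 2)"
      by (rule packing_mono) auto
    then show ?thesis
      using 1 by (auto simp: div_add)
  next
    case 2
    then show ?thesis
      using lift[of t u] IH Node2.prems by auto
  next
    case 3
    have "?odd (Node2 x u t)"
      using 3 Node2.prems IH by (intro lift) auto
    then show ?thesis
      using 3 swap by simp
  next
    case 4
    obtain m b where q: "is_path V E (m @ [b])" "b \<in> A" "set m \<inter> A = {}"
      "hd (m @ [b]) = root t" "set (m @ [b]) \<subseteq> verts t" "length m \<ge> min_depth t"
      "packing (verts t - set (m @ [b])) (leaves t div 2)"
      using IH(2) 4 by auto
    obtain m' b' where q': "is_path V E (m' @ [b'])" "b' \<in> A" "set m' \<inter> A = {}"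
      "hd (m' @ [b']) = root u" "set (m' @ [b']) \<subseteq> verts u" "length m' \<ge> min_depth u"
      "packing (verts u - set (m' @ [b'])) (leaves u div 2)"
      using IH(4) 4 by auto
    \<comment> \<open>The two open paths are joined through \<open>x\<close>. The result has length
      \<open>length m + length m' + 2\<close>, which is at least \<open>l\<close> by the condition
      at \<open>Node2\<close>.\<close>
    define p where "p = b # (rev m @ x # m') @ [b']"
    have p_eq: "p = rev (m @ [b]) @ x # (m' @ [b'])"
      by (simp add: p_def)
    have set_p: "set p = insert x (set (m @ [b]) \<union> set (m' @ [b']))"
      by (auto simp: p_eq)
    have paths: "distinct (m @ [b])" "set (m @ [b]) \<subseteq> V" "successively E (m @ [b])"
      "distinct (m' @ [b'])" "set (m' @ [b']) \<subseteq> V" "successively E (m' @ [b'])"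
      using q(1) q'(1) by (simp_all add: is_path_iff_successively)
    have x: "x \<notin> verts t" "x \<notin> verts u" "x \<in> V" "E (root t) x" "E x (root u)"
      and disj: "verts t \<inter> verts u = {}"
      using Node2.prems E_sym by auto
    have "successively E p"
      unfolding p_eq successively_append_iff successively_rev successively_Cons last_rev
      using paths(3,6) q(4) q'(4) x(4,5) by (auto simp: successively_append_iff)
    moreover have "distinct p"
      unfolding p_eq using paths(1,4) q(5) q'(5) x(1,2) disj by auto
    moreover have "set p \<subseteq> V"
      unfolding set_p using paths(2,5) x(3) by blast
    ultimately have "is_path V E p"
      by (simp add: is_path_iff_successively p_def)
    then have "is_A_path V E A p"
      unfolding is_A_path_iff using q(2,3) q'(2,3) Node2.prems
      by (intro exI[of _ b] exI[of _ "rev m @ x # m'"] exI[of _ b']) (auto simp: p_def)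
    moreover have "path_len p \<ge> l"
      using q(6) q'(6) Node2.prems by (simp add: p_def path_len_def)
    ultimately have "packing (set p) 1"
      by (intro packing_1) (simp add: long_A_path_def)
    then have "packing (set p \<union> ((verts t - set (m @ [b])) \<union> (verts u - set (m' @ [b']))))
        (1 + (leaves t div 2 + leaves u div 2))"
      using q(5,7) q'(5,7) Node2.prems unfolding set_p by (intro packing_Un) auto
    moreover have "1 + (leaves t div 2 + leaves u div 2) = leaves (Node2 x t u) div 2"
      using 4 by (auto elim!: oddE)
    ultimately have "packing (verts (Node2 x t u)) (leaves (Node2 x t u) div 2)"
      using q(5) q'(5) unfolding set_p by (auto elim!: packing_mono)
    then show ?thesis
      using 4 by auto
  qed
qed

section \<open>Attaching a tree at a vertex far from all leaves\<close>

text \<open>The vertex \<open>x\<close> becomes a branching. The new leaves may lower the minimum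
  depth; the last alternative then keeps them \<open>l\<close> away from a leaf at distance
  \<open>d\<close>, which the branchings above need.\<close>

lemma frame_tree_attach:
  assumes "frame_tree t" "frame_tree u" "verts t \<inter> verts u = {}"
    and "x \<in> verts t - near t d" "E x (root u)"
  shows "\<exists>t'. frame_tree t' \<and> root t' = root t \<and> verts t' = verts t \<union> verts u
    \<and> (min_depth t' \<ge> min_depth t \<or> min_depth t' + d \<ge> l)"
  using assms
proof (induction t arbitrary: d)
  case (Leaf a)
  then show ?case by simp
next
  case (Node1 y t)
  show ?case
  proof (cases "x = y")
    case True
    \<comment> \<open>The leaves below \<open>x\<close> are so far away that the branching condition
      holds for every \<open>u\<close>, and \<open>d\<close> alone gives the second
      alternative.\<close>
    then have "l \<le> d" "l \<le> min_depth t + 1"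
      using Node1.prems(4) by (auto split: if_splits)
    then show ?thesis
      using Node1.prems True by (intro exI[of _ "Node2 y t u"]) (auto simp: min_def)
  next
    case False
    then obtain t' where "frame_tree t' \<and> root t' = root t \<and> verts t' = verts t \<union> verts u
        \<and> (min_depth t' \<ge> min_depth t \<or> min_depth t' + (d + 1) \<ge> l)"
      using Node1.IH[of "d + 1"] Node1.prems by auto
    then show ?thesis
      using Node1.prems by (intro exI[of _ "Node1 y t'"]) auto
  qed
next
  case (Node2 y t1 t2)
  have "x \<noteq> y"
    using Node2.prems(4) by auto
  then consider "x \<in> verts t1" | "x \<in> verts t2"
    using Node2.prems(4) by auto
  then show ?case
  proof cases
    case 1
    \<comment> \<open>A leaf outside \<open>t1\<close> is reached through \<open>y\<close>, going up
      or into \<open>t2\<close>. The second entry of the minimum yields the condition at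
      \<open>y\<close>, the first one the claim for \<open>d\<close>.\<close>
    then obtain t' where "frame_tree t' \<and> root t' = root t1 \<and> verts t' = verts t1 \<union> verts u
        \<and> (min_depth t' \<ge> min_depth t1 \<or> min_depth t' + min (d + 1) (min_depth t2 + 2) \<ge> l)"
      using Node2.IH(1)[of "min (d + 1) (min_depth t2 + 2)"] Node2.prems by auto
    then show ?thesis
      using Node2.prems by (intro exI[of _ "Node2 y t' t2"]) (auto simp: min_def split: if_splits)
  next
    case 2
    then obtain t' where "frame_tree t' \<and> root t' = root t2 \<and> verts t' = verts t2 \<union> verts u
        \<and> (min_depth t' \<ge> min_depth t2 \<or> min_depth t' + min (d + 1) (min_depth t1 + 2) \<ge> l)"
      using Node2.IH(2)[of "min (d + 1) (min_depth t1 + 2)"] Node2.prems by auto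
    then show ?thesis
      using Node2.prems by (intro exI[of _ "Node2 y t1 t'"]) (auto simp: min_def split: if_splits)
  qed
qed

lemma frame_tree_chain:
  assumes "is_path V E xs" "last xs \<in> A" "set (butlast xs) \<inter> A = {}"
  shows "frame_tree (chain xs)"
  using assms
proof (induction xs rule: chain.induct)
  case (3 x y xs)
  then show ?case
    by (auto simp: is_path_iff_successively verts_chain root_chain)
qed (auto simp: is_path_def)

section \<open>Frames as lists of rooted components\<close>

text \<open>The conditions at branchings do not see the root leaf \<open>r\<close>, so its distance
  to the other leaves of its component has a clause of its own.\<close>

fun frame :: "('a \<times> 'a btree) list \<Rightarrow> bool"
  and frame_verts :: "('a \<times> 'a btree) list \<Rightarrow> 'a set" where
  "frame [] \<longleftrightarrow> True"
| "frame ((r, t) # fs) \<longleftrightarrow> r \<in> A \<and> r \<notin> verts t \<and> E r (root t) \<and> frame_tree t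
     \<and> min_depth t + 1 \<ge> l \<and> insert r (verts t) \<inter> frame_verts fs = {} \<and> frame fs"
| "frame_verts [] = {}"
| "frame_verts ((r, t) # fs) = insert r (verts t) \<union> frame_verts fs"

text \<open>The only leaf of the component outside \<open>t\<close> is \<open>r\<close>, at distance
  1 from the root of \<open>t\<close>.\<close>

fun frame_near :: "('a \<times> 'a btree) list \<Rightarrow> 'a set" where
  "frame_near [] = {}"
| "frame_near ((r, t) # fs) = insert r (near t 1) \<union> frame_near fs"

text \<open>The root leaf adds one to \<open>leaves t\<close>, and the disjoint paths use up leaves
  in pairs.\<close>

fun frame_size :: "('a \<times> 'a btree) list \<Rightarrow> nat" where
  "frame_size [] = 0"
| "frame_size ((r, t) # fs) = (leaves t + 1) div 2 + frame_size fs"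

lemma frame_verts_subset: "frame fs \<Longrightarrow> frame_verts fs \<subseteq> V"
  using A_subset by (induction fs) (auto dest: subsetD[OF frame_tree_verts_subset])

lemma frame_near_subset: "frame_near fs \<subseteq> frame_verts fs"
  by (induction fs) (auto dest: subsetD[OF near_subset])

lemma frame_A_near: "frame fs \<Longrightarrow> frame_verts fs \<inter> A \<subseteq> frame_near fs"
  by (induction fs) (auto dest: subsetD[OF frame_tree_A_near])

lemma card_frame_near: "card (frame_near fs) \<le> 4 * l * frame_size fs"
proof (induction fs)
  case (Cons c fs)
  obtain r t where c: "c = (r, t)"
    by (cases c)
  have "card (frame_near (c # fs)) \<le> card (insert r (near t 1)) + card (frame_near fs)"
    unfolding c by (simp only: frame_near.simps card_Un_le)
  moreover have "card (insert r (near t 1)) \<le> 1 + card (near t 1)"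
    by (simp add: card_insert_le_m1 card_insert_if finite_subset[OF near_subset])
  \<comment> \<open>For \<open>d = 1\<close> the summand \<open>l\<close> on the left of
    \<open>card_near\<close> exceeds \<open>l - d\<close> by one, which pays for
    \<open>r\<close>.\<close>
  moreover have "1 + card (near t 1) \<le> 2 * leaves t * l"
    using card_near[of t 1] l_pos by linarith
  moreover have "2 * leaves t * l \<le> 4 * ((leaves t + 1) div 2) * l"
    by (intro mult_right_mono) auto
  ultimately have "card (frame_near (c # fs)) \<le> 4 * ((leaves t + 1) div 2) * l + 4 * l * frame_size fs"
    using Cons.IH by linarith
  then show ?case
    unfolding c by (simp add: algebra_simps)
qed simp

lemma frame_packing: "frame fs \<Longrightarrow> packing (frame_verts fs) (frame_size fs)"
proof (induction fs)
  case (Cons c fs)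
  obtain r t where c: "c = (r, t)"
    by (cases c)
  have rt: "r \<in> A" "r \<notin> verts t" "E r (root t)" "frame_tree t" "min_depth t + 1 \<ge> l"
    and disj: "insert r (verts t) \<inter> frame_verts fs = {}" and fs: "frame fs"
    using Cons.prems unfolding c by auto
  have "packing (insert r (verts t)) ((leaves t + 1) div 2)"
  proof (cases "even (leaves t)")
    case True
    then show ?thesis
      using frame_tree_packing[OF rt(4)] by (auto elim: packing_mono)
  next
    case False
    then obtain m b where q: "is_path V E (m @ [b])" "b \<in> A" "set m \<inter> A = {}"
      "hd (m @ [b]) = root t" "set (m @ [b]) \<subseteq> verts t" "length m \<ge> min_depth t"
      "packing (verts t - set (m @ [b])) (leaves t div 2)"
      using frame_tree_packing[OF rt(4)] by auto
    \<comment> \<open>The leaf \<open>b\<close> left over below is joined to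
      \<open>r\<close>.\<close>
    have "is_path V E (r # m @ [b])"
      using q(1,4,5) rt A_subset by (cases m) (auto simp: is_path_iff_successively)
    then have "is_A_path V E A (r # m @ [b])"
      unfolding is_A_path_iff using q rt by blast
    then have "long_A_path l V E A (r # m @ [b])"
      using q(6) rt(5) by (simp add: long_A_path_def path_len_def)
    then have "packing (set (r # m @ [b]) \<union> (verts t - set (m @ [b]))) (1 + leaves t div 2)"
      using q(7) rt(2) by (intro packing_Un packing_1) auto
    moreover have "1 + leaves t div 2 = (leaves t + 1) div 2"
      using False by (auto elim!: oddE)
    ultimately show ?thesis
      using q(5) by (auto elim!: packing_mono)
  qed
  then have "packing (insert r (verts t) \<union> frame_verts fs) ((leaves t + 1) div 2 + frame_size fs)"
    using Cons.IH[OF fs] disj by (rule packing_Un)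
  then show ?case
    unfolding c by simp
qed simp

lemma frame_attach:
  assumes "frame fs" "frame_tree u" "frame_verts fs \<inter> verts u = {}"
    and "x \<in> frame_verts fs - frame_near fs" "E x (root u)"
  shows "\<exists>fs'. frame fs' \<and> frame_verts fs' = frame_verts fs \<union> verts u"
  using assms
proof (induction fs)
  case (Cons c fs)
  obtain r t where c: "c = (r, t)"
    by (cases c)
  consider "x \<in> verts t - near t 1" | "x \<in> frame_verts fs - frame_near fs"
    using Cons.prems(4) unfolding c by auto
  then show ?case
  proof cases
    case 1
    \<comment> \<open>For \<open>d = 1\<close> either alternative yields the distance bound at
      \<open>r\<close>.\<close>
    then obtain t' where "frame_tree t' \<and> root t' = root t \<and> verts t' = verts t \<union> verts u
        \<and> (min_depth t' \<ge> min_depth t \<or> min_depth t' + 1 \<ge> l)"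
      using frame_tree_attach[of t u x 1] Cons.prems unfolding c by auto
    then show ?thesis
      using Cons.prems unfolding c by (intro exI[of _ "(r, t') # fs"]) auto
  next
    case 2
    then obtain fs' where "frame fs' \<and> frame_verts fs' = frame_verts fs \<union> verts u"
      using Cons unfolding c by auto
    then show ?thesis
      using Cons.prems unfolding c by (intro exI[of _ "(r, t) # fs'"]) auto
  qed
qed simp

section \<open>Extending a frame until its near vertices hit all long \<open>A\<close>-paths\<close>

lemma frame_extend:
  assumes fs: "frame fs" and p: "long_A_path l V E A p" and avoid: "set p \<inter> frame_near fs = {}"
  shows "\<exists>fs'. frame fs' \<and> frame_verts fs \<subset> frame_verts fs'"
proof -
  obtain a m b where ab: "p = a # m @ [b]" "is_path V E p" "a \<in> A" "b \<in> A" "set m \<inter> A = {}"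
    and len: "path_len p \<ge> l"
    using p unfolding long_A_path_def is_A_path_iff by blast
  have path: "distinct p" "set p \<subseteq> V" "successively E p"
    using ab(2) by (auto simp: is_path_iff_successively)
  \<comment> \<open>All frame vertices in \<open>A\<close> belong to \<open>frame_near\<close>, so
    \<open>p\<close> can meet the frame only in its interior.\<close>
  have new: "a \<notin> frame_verts fs" "b \<notin> frame_verts fs"
    using frame_A_near[OF fs] avoid ab by auto
  show ?thesis
  proof (cases "set m \<inter> frame_verts fs = {}")
    case True
    define t where "t = chain (m @ [b])"
    have "is_path V E (m @ [b])"
      using path unfolding ab(1) by (auto simp: is_path_iff_successively successively_Cons)
    then have "frame_tree t"
      unfolding t_def using ab by (intro frame_tree_chain) auto
    moreover have "verts t = set (m @ [b])" "root t = hd (m @ [b])" "min_depth t = length m"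
      by (simp_all add: t_def verts_chain root_chain min_depth_chain)
    moreover have "E a (hd (m @ [b]))"
      using path(3) unfolding ab(1) by (auto simp: successively_Cons)
    ultimately have "frame ((a, t) # fs)"
      using ab path(1) len new True fs by (auto simp: path_len_def)
    then show ?thesis
      using new by (intro exI[of _ "(a, t) # fs"]) auto
  next
    case False
    then obtain m1 x m2 where m: "m = m1 @ x # m2" "x \<in> frame_verts fs"
      "set m1 \<inter> frame_verts fs = {}"
      using split_list_first_prop[of m "\<lambda>v. v \<in> frame_verts fs"] by blast
    \<comment> \<open>The segment before the first frame vertex \<open>x\<close>, reversed so that
      it starts next to \<open>x\<close> and ends in the new leaf \<open>a\<close>.\<close>
    define q where "q = rev (a # m1)"
    have p_eq: "p = (a # m1) @ x # m2 @ [b]"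
      by (simp add: ab(1) m(1))
    have "successively E (a # m1)" "E (last (a # m1)) x"
      using path(3) unfolding p_eq successively_append_iff by auto
    then have "is_path V E q" "E x (hd q)"
      unfolding q_def is_path_iff_successively successively_rev hd_rev
      using path(1,2) E_sym unfolding p_eq by auto
    moreover have "set (butlast q) \<inter> A = {}" "last q \<in> A" "q \<noteq> []" "set q = insert a (set m1)"
      using ab(3,5) unfolding q_def m(1) by auto
    ultimately have "frame_tree (chain q)" "E x (root (chain q))" "verts (chain q) = insert a (set m1)"
      by (auto simp: frame_tree_chain root_chain verts_chain)
    moreover have "x \<notin> frame_near fs"
      using avoid unfolding p_eq by auto
    ultimately obtain fs' where "frame fs'" "frame_verts fs' = frame_verts fs \<union> insert a (set m1)"
      using frame_attach[OF fs, of "chain q" x] m new by auto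
    then show ?thesis
      using new by blast
  qed
qed

text \<open>Each extension strictly enlarges the vertex set inside the finite set \<open>V\<close>,
  so the process stops.\<close>

lemma frame_hitting:
  assumes "frame fs"
  shows "\<exists>fs'. frame fs' \<and> (\<forall>p. long_A_path l V E A p \<longrightarrow> set p \<inter> frame_near fs' \<noteq> {})"
  using assms
proof (induction "card (V - frame_verts fs)" arbitrary: fs rule: less_induct)
  case less
  show ?case
  proof (cases "\<forall>p. long_A_path l V E A p \<longrightarrow> set p \<inter> frame_near fs \<noteq> {}")
    case False
    then obtain fs' where fs': "frame fs'" "frame_verts fs \<subset> frame_verts fs'"
      using frame_extend[OF less.prems] by blast
    then have "V - frame_verts fs' \<subset> V - frame_verts fs"
      using frame_verts_subset[OF fs'(1)] by blast
    then show ?thesis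
      using less.hyps fs'(1) finite_V by (meson finite_Diff psubset_card_mono)
  qed (use less.prems in blast)
qed

end

theorem theorem6:
  fixes l k :: nat and V A :: "'a set" and E :: "'a \<Rightarrow> 'a \<Rightarrow> bool"
  assumes "l > 0" and "k > 0" and "finite_graph V E" and "A \<subseteq> V"
  shows "(\<exists>P :: nat \<Rightarrow> 'a list.
            (\<forall>i<k. long_A_path l V E A (P i))
          \<and> (\<forall>i<k. \<forall>j<k. i \<noteq> j \<longrightarrow> set (P i) \<inter> set (P j) = {}))
       \<or> (\<exists>X. X \<subseteq> V \<and> card X \<le> 4 * k * l
            \<and> (\<forall>p. long_A_path l V E A p \<longrightarrow> set p \<inter> X \<noteq> {}))"
proof -
  interpret long_A_paths l V A E
    using assms by unfold_locales
  obtain fs where fs: "frame fs"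
    and hit: "\<forall>p. long_A_path l V E A p \<longrightarrow> set p \<inter> frame_near fs \<noteq> {}"
    using frame_hitting[of "[]"] by auto
  show ?thesis
  \<comment> \<open>The same frame serves both outcomes: \<open>frame_size\<close> counts its
    disjoint paths and, times \<open>4 * l\<close>, bounds its hitting set.\<close>
  proof (cases "k \<le> frame_size fs")
    case True
    then show ?thesis
      using packing_imp_disjoint_paths[OF frame_packing[OF fs]] by blast
  next
    case False
    then have "4 * l * frame_size fs \<le> 4 * k * l"
      by simp
    then have "card (frame_near fs) \<le> 4 * k * l"
      using card_frame_near[of fs] by linarith
    moreover have "frame_near fs \<subseteq> V"
      using frame_near_subset frame_verts_subset[OF fs] by blast
    ultimately show ?thesis
      using hit by blast
  qed
qed

end
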